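(* Let $\theta_0<\theta_1$, $\varepsilon>0$, $\gamma\in(0,1)$, $s>1$ be fixed, let $\nu_{\theta_i}$ be the Bernoulli distribution with natural parameter $\theta_i$, and let $\tau$ be the stopping time of DP-SPRT with Laplace noise (defined in the context) with error levels $\alpha,\beta\in(0,1)$. Then $$\limsup_{\beta\to0}\frac{\mathbb{E}_{\theta_0}[\tau]}{\log(1/\beta)}\le48\max\left(\frac{1}{\mathrm{KL}(\nu_{\theta_0},\nu_{\theta_1})},\frac{\theta_1-\theta_0}{\mathrm{KL}(\nu_{\theta_0},\nu_{\theta_1})\,\varepsilon}\right)$$ and $$\limsup_{\alpha\to0}\frac{\mathbb{E}_{\theta_1}[\tau]}{\log(1/\alpha)}\le48\max\left(\frac{1}{\mathrm{KL}(\nu_{\theta_1},\nu_{\theta_0})},\frac{\theta_1-\theta_0}{\mathrm{KL}(\nu_{\theta_1},\nu_{\theta_0})\,\varepsilon}\right).$$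
   Context: The Bernoulli distribution with natural parameter $\theta\in\mathbb{R}$ has mean $e^\theta/(1+e^\theta)$; $\mu_i$ is the mean of $\nu_{\theta_i}$, $\mathrm{KL}$ the Kullback–Leibler divergence, $\zeta$ the Riemann zeta function, $\mathrm{Lap}(b)$ the centered Laplace distribution of scale $b$. Under $\mathbb{P}_\theta$ (expectation $\mathbb{E}_\theta$), $X_1,X_2,\dots$ are i.i.d. with law $\nu_\theta$. DP-SPRT with Laplace noise: sample $Z\sim\mathrm{Lap}(2/\varepsilon)$ once and $Y_1,Y_2,\dots$ i.i.d. $\mathrm{Lap}(4/\varepsilon)$, all independent of each other and of the data; let $C(n,\delta)=\frac{6\log(n^s\zeta(s)/\delta)}{n\varepsilon}$. With $\bar X_n=\frac1n\sum_{i=1}^nX_i$ and $$\tilde\ell_0^n=\mu_0+\frac{\mathrm{KL}(\nu_{\theta_0},\nu_{\theta_1})-\frac{\log(1/(\gamma\beta))}{n}}{\theta_1-\theta_0}-C(n,(1-\gamma)\beta),\qquad\tilde\ell_1^n=\mu_1-\frac{\mathrm{KL}(\nu_{\theta_1},\nu_{\theta_0})-\frac{\log(1/(\gamma\alpha))}{n}}{\theta_1-\theta_0}+C(n,(1-\gamma)\alpha),$$ set $\tau_0=\inf\{n\ge1:\bar X_n+\frac{Y_n}{n}\le\tilde\ell_0^n-\frac Zn\}$, $\tau_1=\inf\{n\ge1:\bar X_n+\frac{Y_n}{n}\ge\tilde\ell_1^n+\frac Zn\}$, and $\tau=\min(\tau_0,\tau_1)$. *)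

theory Defs
  imports "HOL-Probability.Probability"
begin

(* Law on the reals, carried by {0,1}. *)
definition bern :: "real \<Rightarrow> real measure" where
  "bern \<theta> = distr (measure_pmf (bernoulli_pmf (exp \<theta> / (1 + exp \<theta>)))) borel of_bool"

definition bern_mean :: "real \<Rightarrow> real" where
  "bern_mean \<theta> = (\<integral>x. x \<partial>bern \<theta>)"

(* KL_divergence b M N is the divergence of N relative to M, hence the swapped arguments:
   KL \<theta> \<theta>' stands for KL(\<nu>_\<theta>, \<nu>_\<theta>'), in nats. *)
definition KL :: "real \<Rightarrow> real \<Rightarrow> real" where
  "KL \<theta> \<theta>' = KL_divergence (exp 1) (bern \<theta>') (bern \<theta>)"

definition laplace_density :: "real \<Rightarrow> real \<Rightarrow> real" where
  "laplace_density b x = exp (- \<bar>x\<bar> / b) / (2 * b)"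

(* Riemann zeta function on the real half-line s > 1. *)
definition zeta_real :: "real \<Rightarrow> real" where
  "zeta_real s = (\<Sum>n. 1 / real (Suc n) powr s)"

(* The index sum type makes the data X 1, X 2, ..., the query noise Y 1, Y 2, ...
   and the threshold noise Z one jointly independent family; X 0 and Y 0 are unconstrained. *)
definition dp_sprt_model ::
  "real \<Rightarrow> real \<Rightarrow> 'a measure \<Rightarrow> (nat \<Rightarrow> 'a \<Rightarrow> real) \<Rightarrow> (nat \<Rightarrow> 'a \<Rightarrow> real) \<Rightarrow> ('a \<Rightarrow> real) \<Rightarrow> bool"
where
  "dp_sprt_model \<epsilon> \<theta> M X Y Z \<longleftrightarrow>
     prob_space M \<and>
     prob_space.indep_vars M (\<lambda>_. borel) (case_sum X (case_sum Y (\<lambda>_::unit. Z)))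
       ({1..} <+> ({1..} <+> UNIV)) \<and>
     (\<forall>i\<ge>1. distr M borel (X i) = bern \<theta>) \<and>
     (\<forall>i\<ge>1. distributed M lborel (Y i) (\<lambda>x. ennreal (laplace_density (4 / \<epsilon>) x))) \<and>
     distributed M lborel Z (\<lambda>x. ennreal (laplace_density (2 / \<epsilon>) x))"

definition corr :: "real \<Rightarrow> real \<Rightarrow> nat \<Rightarrow> real \<Rightarrow> real" where
  "corr \<epsilon> s n \<delta> = 6 * ln (real n powr s * zeta_real s / \<delta>) / (real n * \<epsilon>)"

definition lower_threshold ::
  "real \<Rightarrow> real \<Rightarrow> real \<Rightarrow> real \<Rightarrow> real \<Rightarrow> real \<Rightarrow> nat \<Rightarrow> real" where
  "lower_threshold \<theta>0 \<theta>1 \<epsilon> \<gamma> s \<beta> n =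
     bern_mean \<theta>0 + (KL \<theta>0 \<theta>1 - ln (1 / (\<gamma> * \<beta>)) / real n) / (\<theta>1 - \<theta>0)
       - corr \<epsilon> s n ((1 - \<gamma>) * \<beta>)"

definition upper_threshold ::
  "real \<Rightarrow> real \<Rightarrow> real \<Rightarrow> real \<Rightarrow> real \<Rightarrow> real \<Rightarrow> nat \<Rightarrow> real" where
  "upper_threshold \<theta>0 \<theta>1 \<epsilon> \<gamma> s \<alpha> n =
     bern_mean \<theta>1 - (KL \<theta>1 \<theta>0 - ln (1 / (\<gamma> * \<alpha>)) / real n) / (\<theta>1 - \<theta>0)
       + corr \<epsilon> s n ((1 - \<gamma>) * \<alpha>)"

definition sample_mean :: "(nat \<Rightarrow> 'a \<Rightarrow> real) \<Rightarrow> nat \<Rightarrow> 'a \<Rightarrow> real" where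
  "sample_mean X n \<omega> = (\<Sum>i=1..n. X i \<omega>) / real n"

(* In enat the infimum of the empty set is \<infinity>: the test may never stop. *)
definition tau0 ::
  "real \<Rightarrow> real \<Rightarrow> real \<Rightarrow> real \<Rightarrow> real \<Rightarrow> (nat \<Rightarrow> 'a \<Rightarrow> real) \<Rightarrow> (nat \<Rightarrow> 'a \<Rightarrow> real) \<Rightarrow> ('a \<Rightarrow> real)
    \<Rightarrow> real \<Rightarrow> 'a \<Rightarrow> enat" where
  "tau0 \<theta>0 \<theta>1 \<epsilon> \<gamma> s X Y Z \<beta> \<omega> =
     Inf (enat ` {n. n \<ge> 1 \<and>
       sample_mean X n \<omega> + Y n \<omega> / real n \<le> lower_threshold \<theta>0 \<theta>1 \<epsilon> \<gamma> s \<beta> n - Z \<omega> / real n})"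

definition tau1 ::
  "real \<Rightarrow> real \<Rightarrow> real \<Rightarrow> real \<Rightarrow> real \<Rightarrow> (nat \<Rightarrow> 'a \<Rightarrow> real) \<Rightarrow> (nat \<Rightarrow> 'a \<Rightarrow> real) \<Rightarrow> ('a \<Rightarrow> real)
    \<Rightarrow> real \<Rightarrow> 'a \<Rightarrow> enat" where
  "tau1 \<theta>0 \<theta>1 \<epsilon> \<gamma> s X Y Z \<alpha> \<omega> =
     Inf (enat ` {n. n \<ge> 1 \<and>
       sample_mean X n \<omega> + Y n \<omega> / real n \<ge> upper_threshold \<theta>0 \<theta>1 \<epsilon> \<gamma> s \<alpha> n + Z \<omega> / real n})"

definition tau ::
  "real \<Rightarrow> real \<Rightarrow> real \<Rightarrow> real \<Rightarrow> real \<Rightarrow> (nat \<Rightarrow> 'a \<Rightarrow> real) \<Rightarrow> (nat \<Rightarrow> 'a \<Rightarrow> real) \<Rightarrow> ('a \<Rightarrow> real)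
    \<Rightarrow> real \<Rightarrow> real \<Rightarrow> 'a \<Rightarrow> enat" where
  "tau \<theta>0 \<theta>1 \<epsilon> \<gamma> s X Y Z \<alpha> \<beta> \<omega> =
     min (tau0 \<theta>0 \<theta>1 \<epsilon> \<gamma> s X Y Z \<beta> \<omega>) (tau1 \<theta>0 \<theta>1 \<epsilon> \<gamma> s X Y Z \<alpha> \<omega>)"

(* Extended nonnegative expectation, so that no integrability is presupposed. *)
definition expect_tau :: "'a measure \<Rightarrow> ('a \<Rightarrow> enat) \<Rightarrow> ennreal" where
  "expect_tau M T = (\<integral>\<^sup>+ \<omega>. ennreal_of_enat (T \<omega>) \<partial>M)"

end

(* tau is at most the one-sided stopping time that is designed to stop under the true parameter.
   With D = KL / (theta1 - theta0) and delta the vanishing error level, continuing past n forces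
     |S_n - n mu| + |Y_n| + |Z| > n D - log(1/delta) (1/(theta1 - theta0) + 6/epsilon) - O(log n).
   For n >= 14 log(1/delta) max(1/KL, (theta1 - theta0)/(KL epsilon)) the log(1/delta) term is at
   most n D / 2, so for all such n beyond a delta-free threshold the deviation exceeds n D / 4.
   These events have summable probabilities (Hoeffding and Laplace tails) that do not depend on
   delta, so E[tau] is at most 14 log(1/delta) max(...) + O(1), well within the constant 48. *)
theory Submission
  imports Defs "HOL-Real_Asymp.Real_Asymp"
begin

section \<open>Bernoulli laws in the natural parameter and positivity of their divergence\<close>

lemma prob_space_bern: "prob_space (bern \<theta>)"
  unfolding bern_def by (rule measure_pmf.prob_space_distr) simp

lemma sets_bern [simp]: "sets (bern \<theta>) = sets borel"
  by (simp add: bern_def)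

lemma emeasure_bern:
  assumes "A \<in> sets borel"
  shows "emeasure (bern \<theta>) A =
    ennreal (exp \<theta> / (1 + exp \<theta>)) * indicator A 1 + ennreal (1 / (1 + exp \<theta>)) * indicator A 0"
proof -
  define p where "p = exp \<theta> / (1 + exp \<theta>)"
  have pos: "1 + exp \<theta> > 0" by (simp add: add_pos_pos)
  have p: "0 \<le> p" "p \<le> 1" "1 - p = 1 / (1 + exp \<theta>)"
    using pos by (auto simp: p_def field_simps)
  have "emeasure (bern \<theta>) A = emeasure (measure_pmf (bernoulli_pmf p)) {b. of_bool b \<in> A}"
    using assms unfolding bern_def p_def by (simp add: emeasure_distr vimage_def)
  also have "\<dots> = ennreal (\<Sum>b\<in>{b. (of_bool b::real) \<in> A}. pmf (bernoulli_pmf p) b)"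
    by (simp add: emeasure_measure_pmf_finite)
  also have "(\<Sum>b\<in>{b. (of_bool b::real) \<in> A}. pmf (bernoulli_pmf p) b) =
      (\<Sum>b\<in>UNIV. if (of_bool b::real) \<in> A then pmf (bernoulli_pmf p) b else 0)"
    by (simp add: sum.If_cases)
  also have "\<dots> = p * indicator A 1 + (1 - p) * indicator A 0"
    using p by (simp add: UNIV_bool)
  also have "ennreal \<dots> = ennreal p * indicator A 1 + ennreal (1 - p) * indicator A 0"
    using p by (simp split: split_indicator)
  finally show ?thesis unfolding p(3) by (simp add: p_def)
qed

lemma integrable_bern:
  fixes f :: "real \<Rightarrow> real"
  assumes "f \<in> borel_measurable borel"
  shows "integrable (bern \<theta>) f"
  unfolding bern_def using assms
  by (subst integrable_distr_eq) (auto intro!: integrable_measure_pmf_finite)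

text \<open>Both atoms have positive mass for every parameter, so the null sets are always the Borel
  sets avoiding 0 and 1.\<close>

lemma absolutely_continuous_bern: "absolutely_continuous (bern \<theta>) (bern \<theta>')"
proof -
  have "1 + exp \<theta> > 0" for \<theta> :: real by (simp add: add_pos_pos)
  then show ?thesis
    unfolding absolutely_continuous_def null_sets_def
    by (auto simp: emeasure_bern ennreal_eq_0_iff divide_le_0_iff not_less[symmetric] split: split_indicator_asm)
qed

lemma bern_inject: "bern \<theta> = bern \<theta>' \<Longrightarrow> \<theta> = \<theta>'"
proof -
  assume "bern \<theta> = bern \<theta>'"
  then have "emeasure (bern \<theta>) {0} = emeasure (bern \<theta>') {0}" by simp
  moreover have "1 + exp \<theta> > 0" for \<theta> :: real by (simp add: add_pos_pos)
  ultimately show "\<theta> = \<theta>'"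
    by (simp add: emeasure_bern less_imp_le)
qed

text \<open>This is strict Gibbs inequality. Mutual absolute continuity yields a real density
  \<open>D\<close>, integrability is automatic because only two points carry mass, and injectivity
  of the parametrization makes the inequality strict.\<close>

lemma KL_pos:
  assumes "\<theta> \<noteq> \<theta>'"
  shows "KL \<theta> \<theta>' > 0"
proof -
  interpret M: prob_space "bern \<theta>'" by (rule prob_space_bern)
  interpret N: prob_space "bern \<theta>" by (rule prob_space_bern)
  interpret information_space "bern \<theta>'" "exp 1" by standard simp
  have fm: "finite_measure (bern \<theta>)" by unfold_locales
  obtain D where D:
      "D \<in> borel_measurable (bern \<theta>')"
      "AE x in bern \<theta>'. RN_deriv (bern \<theta>') (bern \<theta>) x = ennreal (D x)"
      "AE x in bern \<theta>. 0 < D x"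
      "\<And>x. 0 \<le> D x"
    by (rule M.real_RN_deriv[OF fm absolutely_continuous_bern]) simp_all
  have [measurable]: "D \<in> borel_measurable borel"
    using D(1) by (simp add: measurable_cong_sets[OF sets_bern refl])
  have "bern \<theta> = density (bern \<theta>') (RN_deriv (bern \<theta>') (bern \<theta>))"
    by (rule M.density_RN_deriv[symmetric]) (simp_all add: absolutely_continuous_bern)
  also have "\<dots> = density (bern \<theta>') D"
    using D by (intro density_cong) auto
  finally have N: "bern \<theta> = density (bern \<theta>') D" .
  have "0 < KL_divergence (exp 1) (bern \<theta>') (density (bern \<theta>') D)"
  proof (rule KL_gt_0)
    show "prob_space (density (bern \<theta>') D)"
      unfolding N[symmetric] by (rule prob_space_bern)
    show "density (bern \<theta>') D \<noteq> bern \<theta>'"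
      unfolding N[symmetric] using assms bern_inject by blast
    show "integrable (bern \<theta>') (\<lambda>x. D x * log (exp 1) (D x))"
      by (rule integrable_bern) simp
  qed (use D in auto)
  then show ?thesis unfolding KL_def N[symmetric] .
qed

lemma AE_bern_unit_interval: "AE x in bern \<theta>. x \<in> {0..1}"
  unfolding bern_def by (subst AE_distr_iff) (auto simp: AE_measure_pmf_iff)

section \<open>Reindexed independence and exponential tails of data and noise\<close>

lemma summable_exp_linear:
  assumes "c > (0::real)"
  shows "summable (\<lambda>n. exp (- (c * real n)))"
proof -
  have "exp (- (c * real n)) = exp (- c) ^ n" for n
    by (simp add: exp_of_nat_mult[symmetric] mult.commute)
  then show ?thesis using assms by (simp add: summable_geometric)
qed

context prob_space
begin

lemma indep_sets_reindex:
  assumes f: "inj_on f I" and indep: "indep_sets F (f ` I)"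
  shows "indep_sets (\<lambda>i. F (f i)) I"
proof (rule indep_setsI)
  show "F (f i) \<subseteq> events" if "i \<in> I" for i
    using indep that by (auto simp: indep_sets_def)
  fix A J assume J: "J \<noteq> {}" "J \<subseteq> I" "finite J" and A: "\<forall>j\<in>J. A j \<in> F (f j)"
  have inj: "inj_on f J" using f J(2) by (rule inj_on_subset)
  \<comment> \<open>The chosen events are relabelled by the image indices, which is well defined
    since f is injective on J.\<close>
  define B where "B = (\<lambda>k. A (the_inv_into J f k))"
  have B: "B (f j) = A j" if "j \<in> J" for j
    using that by (simp add: B_def the_inv_into_f_f[OF inj])
  have "prob (\<Inter>k\<in>f ` J. B k) = (\<Prod>k\<in>f ` J. prob (B k))"
    by (rule indep_setsD[OF indep]) (use J A B in auto)
  then show "prob (\<Inter>j\<in>J. A j) = (\<Prod>j\<in>J. prob (A j))"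
    by (simp add: prod.reindex[OF inj] B)
qed

lemma indep_vars_reindex:
  assumes "inj_on f I" "indep_vars N V (f ` I)"
  shows "indep_vars (\<lambda>i. N (f i)) (\<lambda>i. V (f i)) I"
  using assms(2) indep_sets_reindex[OF assms(1)] unfolding indep_vars_def2 by auto

text \<open>The exact tail is exp(-a/b). The weaker rate suffices for summability and is obtained
  without integrating the density over a half-line.\<close>

lemma laplace_tail:
  assumes Y: "distributed M lborel Y (\<lambda>x. ennreal (laplace_density b x))" and b: "b > 0" and "a \<ge> 0"
  shows "prob {\<omega>\<in>space M. \<bar>Y \<omega>\<bar> \<ge> a} \<le> 2 * exp (- a / (2 * b))"
proof -
  have [measurable]: "laplace_density c \<in> borel_measurable borel" for c
    unfolding laplace_density_def[abs_def] by simp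
  have Ym [measurable]: "Y \<in> borel_measurable M"
    using distributed_measurable[OF Y] by simp
  \<comment> \<open>The total mass is 1 because Y has this density under a probability measure; no
    explicit integral is needed.\<close>
  have "(\<integral>\<^sup>+x. ennreal (laplace_density b x) \<partial>lborel) = emeasure (distr M lborel Y) UNIV"
    unfolding distributed_distr_eq_density[OF Y] by (simp add: emeasure_density)
  also have "\<dots> = 1"
    using emeasure_space_1 by (simp add: emeasure_distr)
  finally have one: "(\<integral>\<^sup>+x. ennreal (laplace_density b x) \<partial>lborel) = 1" .
  \<comment> \<open>Doubling the scale dominates the tail and costs only a factor of two in the mass.\<close>
  have scale: "(\<integral>\<^sup>+x. ennreal (laplace_density (2 * b) x) \<partial>lborel) = 1"
  proof -
    have half: "ennreal (laplace_density (2 * b) (2 * x))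
        = ennreal (1 / 2) * ennreal (laplace_density b x)" for x
      using b by (subst ennreal_mult'[symmetric]) (simp_all add: laplace_density_def abs_mult)
    have "(\<integral>\<^sup>+x. ennreal (laplace_density (2 * b) x) \<partial>lborel) =
        ennreal 2 * (\<integral>\<^sup>+x. ennreal (1 / 2) * ennreal (laplace_density b x) \<partial>lborel)"
      by (subst nn_integral_real_affine[where c = 2 and t = 0]) (simp_all add: half)
    also have "\<dots> = ennreal 2 * ennreal (1 / 2)"
      by (subst nn_integral_cmult) (simp_all add: one)
    also have "\<dots> = ennreal (2 * (1 / 2))"
      by (rule ennreal_mult'[symmetric]) simp
    also have "\<dots> = 1" by simp
    finally show ?thesis .
  qed
  have "emeasure M {\<omega>\<in>space M. \<bar>Y \<omega>\<bar> \<ge> a} = emeasure (distr M lborel Y) {x. \<bar>x\<bar> \<ge> a}"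
    by (subst emeasure_distr) (auto intro!: arg_cong[where f = "emeasure M"])
  also have "\<dots> = (\<integral>\<^sup>+x. ennreal (laplace_density b x) * indicator {x. \<bar>x\<bar> \<ge> a} x \<partial>lborel)"
    unfolding distributed_distr_eq_density[OF Y] by (subst emeasure_density) auto
  also have "\<dots> \<le> (\<integral>\<^sup>+x. ennreal (2 * exp (- a / (2 * b))) * ennreal (laplace_density (2 * b) x) \<partial>lborel)"
  proof (rule nn_integral_mono)
    fix x :: real
    have "laplace_density b x \<le> 2 * exp (- a / (2 * b)) * laplace_density (2 * b) x" if "\<bar>x\<bar> \<ge> a"
    proof -
      \<comment> \<open>The exponent is split in half: one factor is bounded by its value at a, the
        other is the exponential of the density with scale 2b.\<close>
      have "exp (- \<bar>x\<bar> / b) = exp (- \<bar>x\<bar> / (2 * b)) * exp (- \<bar>x\<bar> / (2 * b))"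
        by (simp add: exp_add[symmetric] field_simps)
      also have "\<dots> \<le> exp (- a / (2 * b)) * exp (- \<bar>x\<bar> / (2 * b))"
        using that b by (intro mult_right_mono) (auto simp: divide_simps)
      finally show ?thesis using b by (simp add: laplace_density_def field_simps)
    qed
    then show "ennreal (laplace_density b x) * indicator {x. \<bar>x\<bar> \<ge> a} x
        \<le> ennreal (2 * exp (- a / (2 * b))) * ennreal (laplace_density (2 * b) x)"
      by (auto simp: ennreal_mult'[symmetric] intro!: ennreal_leI split: split_indicator)
  qed
  also have "\<dots> = ennreal (2 * exp (- a / (2 * b)))"
    by (subst nn_integral_cmult) (simp_all add: scale)
  finally show ?thesis
    by (simp add: emeasure_eq_measure)
qed

lemma bernoulli_sum_tail:
  assumes indep: "indep_vars (\<lambda>_. borel) X {1..}"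
    and distr: "\<And>i. i \<ge> 1 \<Longrightarrow> distr M borel (X i) = bern \<theta>"
    and "t \<ge> 0" "n \<ge> (1::nat)"
  shows "prob {\<omega>\<in>space M. \<bar>(\<Sum>i=1..n. X i \<omega>) - real n * bern_mean \<theta>\<bar> \<ge> real n * t}
      \<le> 2 * exp (- (2 * t\<^sup>2 * real n))"
proof -
  have rv: "random_variable borel (X i)" if "i \<ge> 1" for i
    using indep that unfolding indep_vars_def by auto
  have E: "expectation (X i) = bern_mean \<theta>" if "i \<ge> 1" for i
    using rv[OF that] unfolding bern_mean_def distr[OF that, symmetric]
    by (simp add: integral_distr)
  define m where "m = (\<Sum>i\<in>{1..n}. expectation (X i))"
  \<comment> \<open>Every summand has range [0,1], so the squared ranges add up to n and a deviation
    of n t gives the exponent -2 (n t)^2 / n.\<close>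
  interpret Hoeffding_ineq M "{1..n}" X "\<lambda>_. 0" "\<lambda>_. 1" m
  proof unfold_locales
    show "indep_vars (\<lambda>_. borel) X {1..n}"
      by (rule indep_vars_subset[OF indep]) auto
    fix i assume "i \<in> {1..n}"
    then have i: "i \<ge> 1" by simp
    have "AE x in distr M borel (X i). x \<in> {0..1}"
      unfolding distr[OF i] by (rule AE_bern_unit_interval)
    then show "AE x in M. X i x \<in> {0..1}"
      by (subst (asm) AE_distr_iff) (use rv[OF i] in auto)
  qed (simp_all add: m_def)
  have m: "m = real n * bern_mean \<theta>"
    unfolding m_def by (simp add: E)
  show ?thesis
    using Hoeffding_ineq_abs_ge[of "real n * t"] assms(3,4)
    by (simp add: m power2_eq_square mult_ac)
qed

lemma summable_deviation:
  assumes indep: "indep_vars (\<lambda>_. borel) X {1..}"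
    and distr: "\<And>i. i \<ge> 1 \<Longrightarrow> distr M borel (X i) = bern \<theta>"
    and Y: "\<And>i. i \<ge> (1::nat) \<Longrightarrow> distributed M lborel (Y i) (\<lambda>x. ennreal (laplace_density b x))"
    and Z: "distributed M lborel Z (\<lambda>x. ennreal (laplace_density b' x))"
    and pos: "b > 0" "b' > 0" "t > 0"
  shows "summable (\<lambda>n. prob {\<omega>\<in>space M.
    \<bar>(\<Sum>i=1..n. X i \<omega>) - real n * bern_mean \<theta>\<bar> + \<bar>Y n \<omega>\<bar> + \<bar>Z \<omega>\<bar> > real n * t})"
proof (rule summable_comparison_test_ev)
  have rv [measurable]: "random_variable borel (X i)" if "i \<ge> 1" for i
    using indep that unfolding indep_vars_def by auto
  have Ym [measurable]: "Y i \<in> borel_measurable M" if "i \<ge> 1" for i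
    using distributed_measurable[OF Y[OF that]] by simp
  have Zm [measurable]: "Z \<in> borel_measurable M"
    using distributed_measurable[OF Z] by simp
  have Sm [measurable]: "(\<lambda>\<omega>. \<Sum>i=1..n. X i \<omega>) \<in> borel_measurable M" for n
    by (intro borel_measurable_sum rv) auto
  \<comment> \<open>If three terms sum to more than n t, one of them is at least n t / 3. The
    summands of \<open>g\<close> are the Hoeffding bound and the two Laplace bounds at that
    level.\<close>
  define g where "g n = 2 * exp (- (2 * (t/3)\<^sup>2 * real n)) + 2 * exp (- (t / (6 * b) * real n))
      + 2 * exp (- (t / (6 * b') * real n))" for n
  show "summable g"
    unfolding g_def using pos
    by (intro summable_add summable_mult summable_exp_linear) auto
  \<comment> \<open>The comparison starts at n = 1, since nothing is assumed about
    \<open>Y 0\<close>.\<close>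
  have "prob {\<omega>\<in>space M. \<bar>(\<Sum>i=1..n. X i \<omega>) - real n * bern_mean \<theta>\<bar> + \<bar>Y n \<omega>\<bar> + \<bar>Z \<omega>\<bar> > real n * t} \<le> g n"
    if n: "n \<ge> 1" for n
  proof -
    note Ym[OF n, measurable]
    let ?A = "{\<omega>\<in>space M. \<bar>(\<Sum>i=1..n. X i \<omega>) - real n * bern_mean \<theta>\<bar> \<ge> real n * (t/3)}"
    let ?B = "{\<omega>\<in>space M. \<bar>Y n \<omega>\<bar> \<ge> real n * (t/3)}"
    let ?C = "{\<omega>\<in>space M. \<bar>Z \<omega>\<bar> \<ge> real n * (t/3)}"
    have "prob {\<omega>\<in>space M. \<bar>(\<Sum>i=1..n. X i \<omega>) - real n * bern_mean \<theta>\<bar> + \<bar>Y n \<omega>\<bar> + \<bar>Z \<omega>\<bar> > real n * t}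
        \<le> prob (?A \<union> ?B \<union> ?C)"
      by (rule finite_measure_mono) auto
    also have "\<dots> \<le> prob ?A + prob ?B + prob ?C"
      by (intro order_trans[OF measure_Un_le] add_mono) auto
    also have "prob ?A \<le> 2 * exp (- (2 * (t/3)\<^sup>2 * real n))"
      by (rule bernoulli_sum_tail[OF indep distr]) (use n pos in auto)
    also have "prob ?B \<le> 2 * exp (- (real n * (t/3)) / (2 * b))"
      by (rule laplace_tail[OF Y]) (use n pos in auto)
    also have "prob ?C \<le> 2 * exp (- (real n * (t/3)) / (2 * b'))"
      by (rule laplace_tail[OF Z]) (use n pos in auto)
    finally show ?thesis
      by (simp add: g_def mult.commute)
  qed
  then show "\<forall>\<^sub>F n in sequentially. norm (prob {\<omega>\<in>space M.
    \<bar>(\<Sum>i=1..n. X i \<omega>) - real n * bern_mean \<theta>\<bar> + \<bar>Y n \<omega>\<bar> + \<bar>Z \<omega>\<bar> > real n * t}) \<le> g n"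
    by (auto simp: eventually_sequentially)
qed

section \<open>Expectation of an extended stopping time through its survival events\<close>

lemma expect_tau_le:
  assumes meas: "\<And>n. A n \<in> events"
    and summ: "summable (\<lambda>n. prob (A n))"
    and sub: "\<And>n \<omega>. n \<ge> N \<Longrightarrow> \<omega> \<in> space M \<Longrightarrow> enat n < T \<omega> \<Longrightarrow> \<omega> \<in> A n"
  shows "expect_tau M T \<le> ennreal (real N + (\<Sum>n. prob (A n)))"
proof -
  \<comment> \<open>Layer-cake argument: T is the number of n with n < T. Indices below N are
    counted in full, later ones only on \<open>A n\<close>.\<close>
  have pw: "ennreal_of_enat (T \<omega>) \<le> (\<Sum>n. of_bool (n < N) + indicator (A n) \<omega>)" if "\<omega> \<in> space M" for \<omega>
  proof -
    have "(\<lambda>i::nat. if enat i < T \<omega> then 1 else 0) sums ennreal_of_enat (T \<omega>)"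
      using sums_If_finite[of "\<lambda>r. enat r < T \<omega>" "\<lambda>_. 1 :: ennreal"]
      \<comment> \<open>For finite T the series has finitely many ones; for infinite T its partial
        sums tend to infinity.\<close>
      by (cases "T \<omega>") (simp_all add: sums_def of_nat_tendsto_top_ennreal)
    then have "ennreal_of_enat (T \<omega>) = (\<Sum>n. if enat n < T \<omega> then 1 else 0)"
      by (simp add: sums_iff)
    also have "\<dots> \<le> (\<Sum>n. of_bool (n < N) + indicator (A n) \<omega>)"
      using sub[OF _ that] by (intro suminf_le) (auto simp: not_less)
    finally show ?thesis .
  qed
  have "expect_tau M T \<le> (\<integral>\<^sup>+\<omega>. (\<Sum>n. of_bool (n < N) + indicator (A n) \<omega>) \<partial>M)"
    unfolding expect_tau_def by (intro nn_integral_mono pw)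
  also have "\<dots> = (\<Sum>n. \<integral>\<^sup>+\<omega>. of_bool (n < N) + indicator (A n) \<omega> \<partial>M)"
    using meas by (intro nn_integral_suminf) auto
  also have "\<dots> = (\<Sum>n. of_bool (n < N) + ennreal (prob (A n)))"
    using meas by (subst nn_integral_add) (auto simp: emeasure_eq_measure prob_space)
  also have "\<dots> = (\<Sum>n. of_bool (n < N)) + (\<Sum>n. ennreal (prob (A n)))"
    by (intro suminf_add[symmetric]) auto
  also have "(\<Sum>n. of_bool (n < N)) = ennreal (real N)"
    using sums_If_finite[of "\<lambda>r. r < N" "\<lambda>_. 1 :: ennreal"]
    by (simp add: sums_iff of_bool_def ennreal_of_nat_eq_real_of_nat)
  also have "(\<Sum>n. ennreal (prob (A n))) = ennreal (\<Sum>n. prob (A n))"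
    using summ by (intro suminf_ennreal2) auto
  finally show ?thesis
    using summ by (simp add: suminf_nonneg)
qed

end

section \<open>Asymptotics of the expected stopping time as the error level vanishes\<close>

lemma zeta_real_pos:
  assumes "s > 1"
  shows "zeta_real s > 0"
proof -
  \<comment> \<open>Convergence comes first, because the value of \<open>suminf\<close> is
    meaningful only for a summable series.\<close>
  have "summable (\<lambda>n. real n powr - s)"
    using assms by (simp add: summable_real_powr_iff)
  then have "summable (\<lambda>n. real (Suc n) powr - s)"
    by (subst summable_Suc_iff)
  then have "summable (\<lambda>n. 1 / real (Suc n) powr s)"
    by (simp add: powr_minus_divide)
  then show ?thesis
    unfolding zeta_real_def by (intro suminf_pos) auto
qed

text \<open>Common form of both limits: K is the relevant divergence, \<Delta> the parameter gap,
  \<delta> the vanishing level and \<open>W n\<close> a deviation whose law does not involve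
  \<delta>. Hypothesis \<open>T\<close> says that survival past n forces a large deviation.\<close>

lemma Limsup_expect_tau_le:
  fixes W :: "nat \<Rightarrow> 'a \<Rightarrow> real" and T :: "real \<Rightarrow> 'a \<Rightarrow> enat"
  assumes M: "prob_space M"
    and meas: "\<And>n. n \<ge> 1 \<Longrightarrow> W n \<in> borel_measurable M"
    and summ: "\<And>t. t > 0 \<Longrightarrow> summable (\<lambda>n. measure M {\<omega>\<in>space M. W n \<omega> > real n * t})"
    and pos: "K > 0" "\<Delta> > 0" "\<epsilon> > 0" "0 < \<gamma>" "\<gamma> < 1" "s > 1"
    and T: "\<And>n \<delta> \<omega>. n \<ge> 1 \<Longrightarrow> 0 < \<delta> \<Longrightarrow> \<delta> < 1 \<Longrightarrow> \<omega> \<in> space M \<Longrightarrow> enat n < T \<delta> \<omega> \<Longrightarrow>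
        W n \<omega> > real n * ((K - ln (1 / (\<gamma> * \<delta>)) / real n) / \<Delta> - corr \<epsilon> s n ((1 - \<gamma>) * \<delta>))"
  shows "Limsup (at_right 0) (\<lambda>\<delta>. expect_tau M (T \<delta>) / ennreal (ln (1 / \<delta>)))
    \<le> ennreal (48 * max (1 / K) (\<Delta> / (K * \<epsilon>)))"
proof -
  interpret prob_space M by fact
  \<comment> \<open>\<open>m\<close> is the target rate, \<open>D\<close> the drift per observation,
    and \<open>c\<close> collects the terms free of both n and \<delta>.\<close>
  define m where "m = max (1 / K) (\<Delta> / (K * \<epsilon>))"
  define D where "D = K / \<Delta>"
  define c where "c = ln (1 / \<gamma>) / \<Delta> + 6 / \<epsilon> * ln (zeta_real s / (1 - \<gamma>))"
  have D: "D > 0" and m: "m > 0"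
    using pos by (auto simp: D_def m_def less_max_iff_disj)
  note \<zeta> = zeta_real_pos[OF \<open>s > 1\<close>]
  \<comment> \<open>Splitting the logarithms isolates linear drift, log(1/\<delta>), a constant and
    log n. Positivity of zeta justifies the split.\<close>
  have drift: "real n * ((K - ln (1 / (\<gamma> * \<delta>)) / real n) / \<Delta> - corr \<epsilon> s n ((1 - \<gamma>) * \<delta>))
      = real n * D - ln (1 / \<delta>) * (1 / \<Delta> + 6 / \<epsilon>) - c - 6 * s / \<epsilon> * ln (real n)"
    if "n \<ge> 1" "0 < \<delta>" for n \<delta>
  proof -
    have l1: "ln (1 / (\<gamma> * \<delta>)) = ln (1 / \<gamma>) + ln (1 / \<delta>)"
      using that pos by (simp add: ln_div ln_mult)
    have l2: "ln (real n powr s * zeta_real s / ((1 - \<gamma>) * \<delta>))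
        = s * ln (real n) + ln (zeta_real s / (1 - \<gamma>)) + ln (1 / \<delta>)"
      using that pos \<zeta> by (simp add: ln_div ln_mult ln_powr)
    show ?thesis
      unfolding corr_def l1 l2 c_def D_def using that pos by (simp add: field_simps)
  qed
  have "\<forall>\<^sub>F n in sequentially. c + 6 * s / \<epsilon> * ln (real n) \<le> real n * D / 4"
    using D by real_asymp
  then obtain n0 where n0: "\<And>n. n \<ge> n0 \<Longrightarrow> c + 6 * s / \<epsilon> * ln (real n) \<le> real n * D / 4"
    by (auto simp: eventually_sequentially)
  \<comment> \<open>The event at n = 0 is set to be empty because \<open>W 0\<close> is not assumed
    measurable.\<close>
  define A where "A n = (if n = 0 then {} else {\<omega>\<in>space M. W n \<omega> > real n * (D/4)})" for n
  have A: "A n \<in> events" for n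
    using meas[of n] by (auto simp: A_def)
  have A_summ: "summable (\<lambda>n. prob (A n))"
    by (rule summable_comparison_test'[OF summ[of "D/4"], of 0]) (use D in \<open>auto simp: A_def\<close>)
  define C where "C = (\<Sum>n. prob (A n))"
  have C: "C \<ge> 0"
    unfolding C_def using A_summ by (intro suminf_nonneg) auto
  have main: "expect_tau M (T \<delta>) \<le> ennreal (real n0 + 14 * m * ln (1 / \<delta>) + 2 + C)"
    if \<delta>: "0 < \<delta>" "\<delta> < 1" for \<delta>
  proof -
    define L where "L = ln (1 / \<delta>)"
    have L: "L > 0" using \<delta> by (simp add: L_def)
    \<comment> \<open>The three summands ensure, in order, that log n is absorbed, that n is at
      least 1, and that n exceeds 14 m L. The rounding and the 1 cost at most 2.\<close>
    define N where "N = n0 + 1 + nat \<lceil>14 * m * L\<rceil>"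
    have N: "real N \<le> real n0 + 14 * m * L + 2"
      using m L unfolding N_def by simp linarith
    \<comment> \<open>Since 1/\<Delta> \<le> m D and 6/\<epsilon> \<le> 6 m D, the coefficient of L
      is at most 7 m D; the constant 14 = 2 * 7 turns this into half of the drift n D.\<close>
    have rate: "L * (1 / \<Delta> + 6 / \<epsilon>) \<le> real n * (D / 2)" if "n \<ge> N" for n
    proof -
      have "14 * m * L \<le> real N" unfolding N_def by linarith
      then have n: "14 * m * L \<le> real n" using that by linarith
      have "1 / \<Delta> \<le> m * D" "6 / \<epsilon> \<le> 6 * (m * D)"
      proof -
        have "1 / K * D \<le> m * D" "\<Delta> / (K * \<epsilon>) * D \<le> m * D"
          using D by (intro mult_right_mono; simp add: m_def)+
        then show "1 / \<Delta> \<le> m * D" "6 / \<epsilon> \<le> 6 * (m * D)"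
          using pos by (auto simp: D_def)
      qed
      then have "L * (1 / \<Delta> + 6 / \<epsilon>) \<le> L * (7 * (m * D))"
        using L by (intro mult_left_mono) auto
      also have "\<dots> = 14 * m * L * (D / 2)" by simp
      also have "\<dots> \<le> real n * (D / 2)" using n D by (intro mult_right_mono) auto
      finally show ?thesis .
    qed
    have "expect_tau M (T \<delta>) \<le> ennreal (real N + C)"
      unfolding C_def
    proof (rule expect_tau_le[OF A A_summ])
      fix n \<omega> assume n: "n \<ge> N" and \<omega>: "\<omega> \<in> space M" "enat n < T \<delta> \<omega>"
      then have n1: "n \<ge> 1" "n \<ge> n0" by (auto simp: N_def)
      \<comment> \<open>Of the drift n D, one half pays for \<open>rate\<close> and one quarter for
        \<open>n0\<close>; a quarter remains.\<close>
      have "real n * (D / 4) \<le> real n * D - L * (1 / \<Delta> + 6 / \<epsilon>) - c - 6 * s / \<epsilon> * ln (real n)"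
        using rate[OF n] n0[OF n1(2)] by linarith
      also have "\<dots> < W n \<omega>"
        using T[OF n1(1) \<delta> \<omega>] unfolding drift[OF n1(1) \<delta>(1)] L_def .
      finally show "\<omega> \<in> A n" using n1 \<omega> by (simp add: A_def)
    qed
    also have "\<dots> \<le> ennreal (real n0 + 14 * m * L + 2 + C)"
      using N by (intro ennreal_leI) auto
    finally show ?thesis unfolding L_def .
  qed
  \<comment> \<open>Here 34 = 48 - 14: the slack in the constant absorbs the terms bounded in
    \<delta>, as log(1/\<delta>) diverges.\<close>
  have "\<forall>\<^sub>F \<delta> in at_right (0::real). (real n0 + 2 + C) / (34 * m) \<le> ln (1 / \<delta>)"
    by real_asymp
  moreover have "\<forall>\<^sub>F \<delta> in at_right (0::real). 0 < \<delta> \<and> \<delta> < 1"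
    by (auto simp: eventually_at_right_field intro!: exI[of _ 1])
  ultimately have "\<forall>\<^sub>F \<delta> in at_right (0::real).
      expect_tau M (T \<delta>) / ennreal (ln (1 / \<delta>)) \<le> ennreal (48 * m)"
  proof eventually_elim
    case (elim \<delta>)
    then have L: "ln (1 / \<delta>) > 0" by simp
    have "real n0 + 2 + C \<le> 34 * m * ln (1 / \<delta>)"
      using elim(1) m by (simp add: pos_divide_le_eq mult_ac)
    then have "expect_tau M (T \<delta>) \<le> ennreal (48 * m * ln (1 / \<delta>))"
      using elim by (intro order_trans[OF main] ennreal_leI) auto
    then have "expect_tau M (T \<delta>) / ennreal (ln (1 / \<delta>)) \<le> ennreal (48 * m * ln (1 / \<delta>)) / ennreal (ln (1 / \<delta>))"
      by (rule divide_right_mono_ennreal)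
    also have "\<dots> = ennreal (48 * m)"
      using L m by (subst divide_ennreal) auto
    finally show ?case .
  qed
  then show ?thesis unfolding m_def by (rule Limsup_bounded)
qed

section \<open>Application to the lower and the upper test\<close>

lemma less_Inf_enat_imp_not:
  assumes "enat n < Inf (enat ` {k. Q k})"
  shows "\<not> Q n"
  using assms by (auto simp: less_le_not_le intro: Inf_lower)

theorem mainTheorem6:
  fixes \<theta>0 \<theta>1 \<epsilon> \<gamma> s :: real
    and P :: "real \<Rightarrow> 'a measure"
    and X Y :: "nat \<Rightarrow> 'a \<Rightarrow> real"
    and Z :: "'a \<Rightarrow> real"
  assumes "\<theta>0 < \<theta>1" and "\<epsilon> > 0" and "0 < \<gamma>" and "\<gamma> < 1" and "s > 1"
    and "dp_sprt_model \<epsilon> \<theta>0 (P \<theta>0) X Y Z"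
    and "dp_sprt_model \<epsilon> \<theta>1 (P \<theta>1) X Y Z"
  shows
    "(\<forall>\<alpha>\<in>{0<..<1}.
        Limsup (at_right 0) (\<lambda>\<beta>::real.
          expect_tau (P \<theta>0) (tau \<theta>0 \<theta>1 \<epsilon> \<gamma> s X Y Z \<alpha> \<beta>) / ennreal (ln (1 / \<beta>)))
        \<le> ennreal (48 * max (1 / KL \<theta>0 \<theta>1) ((\<theta>1 - \<theta>0) / (KL \<theta>0 \<theta>1 * \<epsilon>)))) \<and>
     (\<forall>\<beta>\<in>{0<..<1}.
        Limsup (at_right 0) (\<lambda>\<alpha>::real.
          expect_tau (P \<theta>1) (tau \<theta>0 \<theta>1 \<epsilon> \<gamma> s X Y Z \<alpha> \<beta>) / ennreal (ln (1 / \<alpha>)))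
        \<le> ennreal (48 * max (1 / KL \<theta>1 \<theta>0) ((\<theta>1 - \<theta>0) / (KL \<theta>1 \<theta>0 * \<epsilon>))))"
proof -
  \<comment> \<open>Absolute values let one deviation control both tests, whatever the signs of the
    centered sum and of the noise.\<close>
  define W where "W \<theta> n \<omega> = \<bar>(\<Sum>i=1..n. X i \<omega>) - real n * bern_mean \<theta>\<bar> + \<bar>Y n \<omega>\<bar> + \<bar>Z \<omega>\<bar>" for \<theta> n \<omega>
  have bound: "Limsup (at_right 0) (\<lambda>\<delta>. expect_tau (P \<theta>) (T \<delta>) / ennreal (ln (1 / \<delta>)))
      \<le> ennreal (48 * max (1 / K) ((\<theta>1 - \<theta>0) / (K * \<epsilon>)))"
    if model: "dp_sprt_model \<epsilon> \<theta> (P \<theta>) X Y Z" and "K > 0"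
      and T: "\<And>n \<delta> \<omega>. n \<ge> 1 \<Longrightarrow> enat n < T \<delta> \<omega> \<Longrightarrow> W \<theta> n \<omega> >
        real n * ((K - ln (1 / (\<gamma> * \<delta>)) / real n) / (\<theta>1 - \<theta>0) - corr \<epsilon> s n ((1 - \<gamma>) * \<delta>))"
    for \<theta> K T
  proof -
    interpret prob_space "P \<theta>" using model by (simp add: dp_sprt_model_def)
    have indep: "indep_vars (\<lambda>_. borel) X {1..}"
    proof -
      have "indep_vars (\<lambda>_. borel) (case_sum X (case_sum Y (\<lambda>_::unit. Z)))
          ({1..} <+> ({1..} <+> UNIV))"
        using model by (simp add: dp_sprt_model_def)
      \<comment> \<open>The data are the left summands of the joint family; reindexing along
        \<open>Inl\<close> recovers \<open>X\<close>.\<close>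
      then have "indep_vars (\<lambda>_. borel) (case_sum X (case_sum Y (\<lambda>_::unit. Z))) (Inl ` {1..})"
        by (rule indep_vars_subset) auto
      from indep_vars_reindex[OF _ this] show ?thesis by simp
    qed
    have distr: "i \<ge> 1 \<Longrightarrow> distr (P \<theta>) borel (X i) = bern \<theta>"
      and Y: "i \<ge> 1 \<Longrightarrow> distributed (P \<theta>) lborel (Y i) (\<lambda>x. ennreal (laplace_density (4 / \<epsilon>) x))"
      and Z: "distributed (P \<theta>) lborel Z (\<lambda>x. ennreal (laplace_density (2 / \<epsilon>) x))" for i
      using model by (auto simp: dp_sprt_model_def)
    show ?thesis
    proof (rule Limsup_expect_tau_le[where W = "W \<theta>" and \<gamma> = \<gamma> and s = s])
      fix n :: nat assume n: "n \<ge> 1"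
      have "random_variable borel (X i)" if "i \<ge> 1" for i
        using indep that unfolding indep_vars_def by auto
      then have [measurable]: "(\<lambda>\<omega>. \<Sum>i=1..n. X i \<omega>) \<in> borel_measurable (P \<theta>)"
        by (intro borel_measurable_sum) auto
      have [measurable]: "Y n \<in> borel_measurable (P \<theta>)" "Z \<in> borel_measurable (P \<theta>)"
        using distributed_measurable[OF Y[OF n]] distributed_measurable[OF Z] by simp_all
      show "W \<theta> n \<in> borel_measurable (P \<theta>)"
        unfolding W_def[abs_def] by measurable
    next
      fix t :: real assume "t > 0"
      then show "summable (\<lambda>n. prob {\<omega>\<in>space (P \<theta>). W \<theta> n \<omega> > real n * t})"
        unfolding W_def using \<open>\<epsilon> > 0\<close>
        by (intro summable_deviation[OF indep distr Y Z]) auto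
    qed (use assms that in \<open>auto intro: prob_space_axioms\<close>)
  qed
  show ?thesis
  proof (intro conjI ballI)
    fix \<alpha> :: real
    show "Limsup (at_right 0) (\<lambda>\<beta>::real.
          expect_tau (P \<theta>0) (tau \<theta>0 \<theta>1 \<epsilon> \<gamma> s X Y Z \<alpha> \<beta>) / ennreal (ln (1 / \<beta>)))
        \<le> ennreal (48 * max (1 / KL \<theta>0 \<theta>1) ((\<theta>1 - \<theta>0) / (KL \<theta>0 \<theta>1 * \<epsilon>)))"
    proof (rule bound)
      fix n :: nat and \<beta> \<omega>
      assume n: "n \<ge> 1" and "enat n < tau \<theta>0 \<theta>1 \<epsilon> \<gamma> s X Y Z \<alpha> \<beta> \<omega>"
      \<comment> \<open>Under \<theta>0 the lower test, governed by the vanishing \<beta>, is the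
        one expected to stop; survival of the minimum implies its survival.\<close>
      then have "enat n < tau0 \<theta>0 \<theta>1 \<epsilon> \<gamma> s X Y Z \<beta> \<omega>" by (simp add: tau_def)
      from less_Inf_enat_imp_not[OF this[unfolded tau0_def]] n
      have "sample_mean X n \<omega> + Y n \<omega> / real n > lower_threshold \<theta>0 \<theta>1 \<epsilon> \<gamma> s \<beta> n - Z \<omega> / real n"
        by auto
      \<comment> \<open>Multiplying by n and cancelling n times the mean leaves S_n - n \<mu>0 + Y_n
        + Z on the large side, which \<open>W\<close> dominates.\<close>
      from mult_strict_left_mono[OF this, of "real n"] n
      show "W \<theta>0 n \<omega> > real n * ((KL \<theta>0 \<theta>1 - ln (1 / (\<gamma> * \<beta>)) / real n) / (\<theta>1 - \<theta>0) - corr \<epsilon> s n ((1 - \<gamma>) * \<beta>))"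
        unfolding W_def lower_threshold_def sample_mean_def
        by (simp add: distrib_left right_diff_distrib)
    qed (use assms in \<open>auto intro: KL_pos\<close>)
  next
    fix \<beta> :: real
    show "Limsup (at_right 0) (\<lambda>\<alpha>::real.
          expect_tau (P \<theta>1) (tau \<theta>0 \<theta>1 \<epsilon> \<gamma> s X Y Z \<alpha> \<beta>) / ennreal (ln (1 / \<alpha>)))
        \<le> ennreal (48 * max (1 / KL \<theta>1 \<theta>0) ((\<theta>1 - \<theta>0) / (KL \<theta>1 \<theta>0 * \<epsilon>)))"
    proof (rule bound)
      fix n :: nat and \<alpha> \<omega>
      assume n: "n \<ge> 1" and "enat n < tau \<theta>0 \<theta>1 \<epsilon> \<gamma> s X Y Z \<alpha> \<beta> \<omega>"
      then have "enat n < tau1 \<theta>0 \<theta>1 \<epsilon> \<gamma> s X Y Z \<alpha> \<omega>" by (simp add: tau_def)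
      from less_Inf_enat_imp_not[OF this[unfolded tau1_def]] n
      have "sample_mean X n \<omega> + Y n \<omega> / real n < upper_threshold \<theta>0 \<theta>1 \<epsilon> \<gamma> s \<alpha> n + Z \<omega> / real n"
        by auto
      \<comment> \<open>With the inequality reversed, the dominated quantity is n \<mu>1 - S_n - Y_n
        + Z.\<close>
      from mult_strict_left_mono[OF this, of "real n"] n
      show "W \<theta>1 n \<omega> > real n * ((KL \<theta>1 \<theta>0 - ln (1 / (\<gamma> * \<alpha>)) / real n) / (\<theta>1 - \<theta>0) - corr \<epsilon> s n ((1 - \<gamma>) * \<alpha>))"
        unfolding W_def upper_threshold_def sample_mean_def
        by (simp add: distrib_left right_diff_distrib)
    qed (use assms in \<open>auto intro: KL_pos\<close>)
  qed
qed

end
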